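(* Let $p$ be an odd prime, $q=p^e$, and let $k\ge3$ be even and coprime to $p$ with $(k,p)$ hyperbolic, i.e. $1/k+1/p<1/2$. Let $\xi_\kappa$ be a primitive $2k$-th root of unity in $GF(q)$ or $GF(q^2)$ and $\omega_\kappa=\xi_\kappa+\xi_\kappa^{-1}$. Consider the regular map of type $(k,p)$ given by the generating triple $(X,Y,Z)$ of matrices determined by $\xi_\kappa$ described in the context, where $G=\langle X,Y,Z\rangle$ is isomorphic to $PSL(2,q)$ or $PGL(2,q)$. Then the map is Möbius regular if and only if $\omega_\kappa^2+4=0$.
   Context: A regular map of type $(k,l)$ (vertex degree $k$, face length $l$) is identified with a group $G$ generated by three involutions $X,Y,Z$ such that $XY$, $YZ$, $ZX$ have orders exactly $2,k,l$ respectively; put $R=YZ$. A regular map is Möbius regular if any two distinct adjacent vertices are joined by exactly two edges and any open set supporting these edges contains a Möbius strip. By a known result (Li and Širáň), this is equivalent to the following group-theoretic condition, which may be taken as the definition: $k$ is even and $XR^{k/2}X=R^{k/2}Y$ in $G$. Matrices are regarded up to nonzero scalar multiples, i.e. as elements of $PGL(2,K)$ with $K$ an algebraic closure of $GF(p)$. For type $(k,p)$ with $k$ coprime to $p$ the generating triple is, with $\alpha^2=-1$ and $\eta=(\xi_\kappa-\xi_\kappa^{-1})^{-1}$, $$X=\eta\alpha\begin{pmatrix}-\omega_\kappa&-2\xi_\kappa\\2\xi_\kappa^{-1}&\omega_\kappa\end{pmatrix},\quad Y=-\alpha\begin{pmatrix}0&\xi_\kappa\\ \xi_\kappa^{-1}&0\end{pmatrix},\quad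 Z=\alpha\begin{pmatrix}0&1\\1&0\end{pmatrix}.$$ *)

theory Defs
  imports "HOL-Analysis.Analysis" "HOL-Algebra.Multiplicative_Group"
    "HOL-Algebra.Generated_Groups" "HOL-Computational_Algebra.Polynomial"
begin

(* The prime subfield GF(p) of a field of characteristic p is the range of of_int. *)
definition is_alg_closure_of_GF :: "'a::alg_closed_field itself \<Rightarrow> nat \<Rightarrow> bool" where
  "is_alg_closure_of_GF T p \<longleftrightarrow> CHAR('a) = p \<and>
     (\<forall>x::'a. \<exists>f. f \<noteq> 0 \<and> (\<forall>i. Polynomial.coeff f i \<in> range of_int) \<and> poly f x = 0)"

(* For q a power of the characteristic, GF(q) is realised as the unique subfield
   of order q of the ambient algebraic closure. *)
definition GF :: "nat \<Rightarrow> 'a::field set" where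
  "GF q = {x. x ^ q = x}"

definition primitive_root_unity :: "nat \<Rightarrow> 'a::field \<Rightarrow> bool" where
  "primitive_root_unity n x \<longleftrightarrow> n > 0 \<and> x ^ n = 1 \<and> (\<forall>m. 0 < m \<and> m < n \<longrightarrow> x ^ m \<noteq> 1)"

definition mat2 :: "'a \<Rightarrow> 'a \<Rightarrow> 'a \<Rightarrow> 'a \<Rightarrow> 'a::zero ^ 2 ^ 2" where
  "mat2 a b c d = vector [vector [a, b], vector [c, d]]"

(* In GL2 and the groups below, F is meant to be (the carrier of) a subfield. *)
definition GL2 :: "'a::field set \<Rightarrow> ('a ^ 2 ^ 2) monoid" where
  "GL2 F = \<lparr>carrier = {A. (\<forall>i j. A $ i $ j \<in> F) \<and> det A \<noteq> 0}, mult = (**), one = mat 1\<rparr>"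

definition SL2 :: "'a::field set \<Rightarrow> ('a ^ 2 ^ 2) monoid" where
  "SL2 F = \<lparr>carrier = {A. (\<forall>i j. A $ i $ j \<in> F) \<and> det A = 1}, mult = (**), one = mat 1\<rparr>"

(* "range mat" is the set of all scalar matrices. *)
definition PGL2 :: "'a::field set \<Rightarrow> ('a ^ 2 ^ 2) set monoid" where
  "PGL2 F = GL2 F Mod (carrier (GL2 F) \<inter> range mat)"

definition PSL2 :: "'a::field set \<Rightarrow> ('a ^ 2 ^ 2) set monoid" where
  "PSL2 F = SL2 F Mod (carrier (SL2 F) \<inter> range mat)"

(* The element of PGL(2,K) represented by an invertible matrix, K being the whole type. *)
definition proj_class :: "'a::field ^ 2 ^ 2 \<Rightarrow> ('a ^ 2 ^ 2) set" where
  "proj_class A = (carrier (GL2 UNIV) \<inter> range mat) #>\<^bsub>GL2 UNIV\<^esub> A"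

definition regular_map ::
  "('g, 'm) monoid_scheme \<Rightarrow> 'g \<Rightarrow> 'g \<Rightarrow> 'g \<Rightarrow> nat \<Rightarrow> nat \<Rightarrow> bool" where
  "regular_map G X Y Z k l \<longleftrightarrow>
     group G \<and> {X, Y, Z} \<subseteq> carrier G \<and> generate G {X, Y, Z} = carrier G \<and>
     group.ord G X = 2 \<and> group.ord G Y = 2 \<and> group.ord G Z = 2 \<and>
     group.ord G (X \<otimes>\<^bsub>G\<^esub> Y) = 2 \<and>
     group.ord G (Y \<otimes>\<^bsub>G\<^esub> Z) = k \<and>
     group.ord G (Z \<otimes>\<^bsub>G\<^esub> X) = l"

(* The algebraic criterion of Li and Siran, taken as the definition. *)
definition moebius_regular ::
  "('g, 'm) monoid_scheme \<Rightarrow> 'g \<Rightarrow> 'g \<Rightarrow> 'g \<Rightarrow> nat \<Rightarrow> nat \<Rightarrow> bool" where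
  "moebius_regular G X Y Z k l \<longleftrightarrow> regular_map G X Y Z k l \<and> even k \<and>
     (let R = Y \<otimes>\<^bsub>G\<^esub> Z; H = R [^]\<^bsub>G\<^esub> (k div 2)
      in X \<otimes>\<^bsub>G\<^esub> H \<otimes>\<^bsub>G\<^esub> X = H \<otimes>\<^bsub>G\<^esub> Y)"

end

theory Submission
  imports Defs
begin

text \<open>Up to scalars, \<open>YZ\<close> is \<open>diag (\<xi>, 1/\<xi>)\<close>, and \<open>ZX\<close> is a unipotent matrix \<open>1 + N\<close> with
  \<open>N \<noteq> 0\<close> and \<open>N\<^sup>2 = 0\<close>, so its \<open>n\<close>-th power \<open>1 + n N\<close> is scalar iff \<open>p\<close> divides \<open>n\<close>; this yields
  the orders. As \<open>\<xi>\<^sup>k = -1\<close>, the involution \<open>(YZ)\<^bsup>k/2\<^esup>\<close> is represented by \<open>diag (1, -1)\<close>, and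
  \<open>X diag (1, -1) X\<close> has diagonal entries \<open>\<plusminus>(\<omega>\<^sup>2 + 4)\<close>, whereas \<open>diag (1, -1) Y\<close> is
  antidiagonal. Comparing the two gives the criterion.\<close>

section \<open>Entrywise calculus of 2x2 matrices\<close>

lemma mat2_nth [simp]:
  "mat2 a b c d $ 1 $ 1 = a" "mat2 a b c d $ 1 $ 2 = b"
  "mat2 a b c d $ 2 $ 1 = c" "mat2 a b c d $ 2 $ 2 = d"
  by (simp_all add: mat2_def)

lemma det_mat2 [simp]: "det (mat2 a b c d :: 'a::comm_ring_1^2^2) = a * d - b * c"
  by (simp add: det_2)

lemma mat2_mult [simp]:
  "mat2 a b c d ** mat2 a' b' c' d' =
     mat2 (a * a' + b * c') (a * b' + b * d') (c * a' + d * c') (c * b' + d * d' :: 'a::comm_ring_1)"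
  by (simp add: vec_eq_iff forall_2 matrix_matrix_mult_def sum_2)

lemma map_matrix_mat2 [simp]: "map_matrix f (mat2 a b c d) = mat2 (f a) (f b) (f c) (f d)"
  by (simp add: vec_eq_iff forall_2 map_matrix_def)

lemma mat2_eq_iff: "mat2 a b c d = mat2 a' b' c' d' \<longleftrightarrow> a = a' \<and> b = b' \<and> c = c' \<and> d = d'"
  by (auto simp: vec_eq_iff forall_2)

lemma mat_eq_mat2: "mat s = mat2 s 0 0 (s :: 'a::comm_ring_1)"
  by (simp add: vec_eq_iff forall_2 mat_def)

lemma mat_scalar_mult: "mat s ** A = map_matrix ((*) s) (A :: 'a::comm_ring_1^'n^'n)"
  by (simp add: vec_eq_iff matrix_matrix_mult_def mat_def map_matrix_def if_distrib if_distribR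
      cong: if_cong)

section \<open>PGL(2,K) as a quotient by the scalar matrices\<close>

abbreviation scalars :: "('a::field^2^2) set" where
  "scalars \<equiv> carrier (GL2 UNIV) \<inter> range mat"

lemma group_GL2: "group (GL2 (UNIV :: 'a::field set))"
proof (rule groupI)
  fix A :: "'a^2^2" assume "A \<in> carrier (GL2 UNIV)"
  then have "invertible A" by (simp add: GL2_def invertible_det_nz)
  then obtain B where "A ** B = mat 1" "B ** A = mat 1" by (auto simp: invertible_def)
  then show "\<exists>B\<in>carrier (GL2 UNIV). B \<otimes>\<^bsub>GL2 UNIV\<^esub> A = \<one>\<^bsub>GL2 UNIV\<^esub>"
    using invertible_det_nz[of B] by (auto simp: GL2_def invertible_def)
qed (auto simp: GL2_def det_mul matrix_mul_assoc)

lemma scalars_eq: "scalars = {mat s | s :: 'a::field. s \<noteq> 0}"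
  by (auto simp: GL2_def mat_eq_mat2)

text \<open>Scalar matrices commute with every matrix, so conjugation fixes each of them and only
  the subgroup laws remain to be checked.\<close>

lemma scalars_normal: "scalars \<lhd> GL2 (UNIV :: 'a::field set)"
proof -
  interpret group "GL2 (UNIV :: 'a set)" by (rule group_GL2)
  have mult_eq [simp]: "mult (GL2 UNIV) = (**)" "\<one>\<^bsub>GL2 UNIV\<^esub> = (mat 1 :: 'a^2^2)"
    by (simp_all add: GL2_def)
  have mat_carrier: "mat s \<in> carrier (GL2 UNIV)" if "s \<noteq> 0" for s :: 'a
    using that by (simp add: GL2_def mat_eq_mat2)
  have mat_mult: "mat s ** mat t = (mat (s * t) :: 'a^2^2)" for s t
    by (simp add: mat_eq_mat2)
  have central: "A ** mat s = mat s ** A" for A :: "'a^2^2" and s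
    by (simp add: vec_eq_iff forall_2 matrix_matrix_mult_def sum_2 mat_eq_mat2 mult.commute)
  show ?thesis
  proof (rule normal_invI)
    show "subgroup scalars (GL2 (UNIV :: 'a set))"
    proof (rule subgroupI)
      fix A :: "'a^2^2" assume "A \<in> scalars"
      then obtain s where s: "s \<noteq> 0" "A = mat s" by (auto simp: scalars_eq)
      then have "inv\<^bsub>GL2 UNIV\<^esub> A = mat (inverse s)"
        by (intro inv_equality) (simp_all add: mat_mult mat_carrier)
      then show "inv\<^bsub>GL2 UNIV\<^esub> A \<in> scalars" using s by (auto simp: mat_carrier)
    next
      fix A B :: "'a^2^2" assume "A \<in> scalars" "B \<in> scalars"
      then show "A \<otimes>\<^bsub>GL2 UNIV\<^esub> B \<in> scalars" by (fastforce simp: scalars_eq mat_mult)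
    qed (auto simp: mat_carrier)
  next
    fix A B :: "'a^2^2" assume A: "A \<in> carrier (GL2 UNIV)" and B: "B \<in> scalars"
    then obtain s where s: "B = mat s" by auto
    from A B have "A \<otimes>\<^bsub>GL2 UNIV\<^esub> B \<otimes>\<^bsub>GL2 UNIV\<^esub> inv\<^bsub>GL2 UNIV\<^esub> A
        = B \<otimes>\<^bsub>GL2 UNIV\<^esub> (A \<otimes>\<^bsub>GL2 UNIV\<^esub> inv\<^bsub>GL2 UNIV\<^esub> A)"
      by (simp add: s central matrix_mul_assoc)
    with A B show "A \<otimes>\<^bsub>GL2 UNIV\<^esub> B \<otimes>\<^bsub>GL2 UNIV\<^esub> inv\<^bsub>GL2 UNIV\<^esub> A \<in> scalars"
      by (simp del: mult_eq)
  qed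
qed

lemma group_PGL2: "group (PGL2 (UNIV :: 'a::field set))"
  unfolding PGL2_def by (rule normal.factorgroup_is_group[OF scalars_normal])

lemma proj_class_carrier: "det A \<noteq> 0 \<Longrightarrow> proj_class A \<in> carrier (PGL2 UNIV)"
  by (auto simp: PGL2_def carrier_FactGroup proj_class_def GL2_def)

lemma proj_class_mult:
  assumes "det A \<noteq> 0" "det B \<noteq> 0"
  shows "proj_class A \<otimes>\<^bsub>PGL2 UNIV\<^esub> proj_class B = proj_class (A ** B)"
proof -
  have "A \<in> carrier (GL2 UNIV)" "B \<in> carrier (GL2 UNIV)"
    using assms by (simp_all add: GL2_def)
  then have "proj_class A \<otimes>\<^bsub>PGL2 UNIV\<^esub> proj_class B = proj_class (A \<otimes>\<^bsub>GL2 UNIV\<^esub> B)"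
    using normal.rcos_sum[OF scalars_normal] by (simp add: PGL2_def proj_class_def)
  then show ?thesis by (simp add: GL2_def)
qed

text \<open>Two cosets of a subgroup agree iff a representative of one lies in the other. Membership
  in the coset of \<open>B\<close> means \<open>A = mat s ** B\<close>, and this product scales all
  entries by \<open>s\<close>.\<close>

lemma proj_class_eq_iff:
  assumes "det A \<noteq> 0" "det B \<noteq> 0"
  shows "proj_class A = proj_class B \<longleftrightarrow> (\<exists>s. s \<noteq> 0 \<and> A = map_matrix ((*) s) B)"
proof -
  interpret group "GL2 (UNIV :: 'a set)" by (rule group_GL2)
  interpret normal scalars "GL2 (UNIV :: 'a set)" by (rule scalars_normal)
  have "A \<in> carrier (GL2 UNIV)" "B \<in> carrier (GL2 UNIV)"
    using assms by (simp_all add: GL2_def)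
  then have "proj_class A = proj_class B \<longleftrightarrow> A \<in> proj_class B"
    unfolding proj_class_def using rcos_self repr_independence is_subgroup by metis
  moreover have "proj_class B = (\<Union>S\<in>scalars. {S ** B})"
    unfolding proj_class_def r_coset_def by (simp add: GL2_def)
  ultimately have "proj_class A = proj_class B \<longleftrightarrow> (\<exists>S\<in>scalars. A = S ** B)" by blast
  then show ?thesis unfolding scalars_eq mat_scalar_mult[symmetric] by blast
qed

lemma proj_class_mat2_eq_iff:
  assumes "a * d - b * c \<noteq> 0" "a' * d' - b' * c' \<noteq> 0"
  shows "proj_class (mat2 a b c d) = proj_class (mat2 a' b' c' d') \<longleftrightarrow>
    (\<exists>s. s \<noteq> 0 \<and> a = s * a' \<and> b = s * b' \<and> c = s * c' \<and> d = s * d')"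
  using assms by (simp add: proj_class_eq_iff mat2_eq_iff)

lemma one_PGL2: "\<one>\<^bsub>PGL2 UNIV\<^esub> = proj_class (mat2 1 0 0 1)"
proof -
  interpret group "GL2 (UNIV :: 'a set)" by (rule group_GL2)
  have "\<one>\<^bsub>PGL2 UNIV\<^esub> = proj_class \<one>\<^bsub>GL2 (UNIV :: 'a set)\<^esub>"
    unfolding PGL2_def proj_class_def by (simp add: coset_mult_one inf.coboundedI1)
  then show ?thesis by (simp add: GL2_def mat_eq_mat2)
qed

text \<open>The scaling factor can only be the common diagonal entry, which is nonzero because the
  determinant is.\<close>

lemma proj_class_mat2_eq_one_iff:
  assumes "a * d - b * c \<noteq> 0"
  shows "proj_class (mat2 a b c d) = \<one>\<^bsub>PGL2 UNIV\<^esub> \<longleftrightarrow> a = d \<and> b = 0 \<and> c = 0"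
  using assms by (auto simp: one_PGL2 proj_class_mat2_eq_iff)

lemma proj_class_diagonal_pow:
  assumes "a \<noteq> 0" "d \<noteq> 0"
  shows "proj_class (mat2 a 0 0 d) [^]\<^bsub>PGL2 UNIV\<^esub> n = proj_class (mat2 (a ^ n) 0 0 (d ^ n))"
  using assms
  by (induction n) (simp_all add: one_PGL2 nat_pow_def proj_class_mult mult.commute)

text \<open>The matrix is \<open>1 + t N\<close> with \<open>N = mat2 (-1) (-1) 1 1\<close>. Since
  \<open>N ** N = 0\<close>, multiplying two such matrices adds their parameters.\<close>

lemma proj_class_unipotent_pow:
  "proj_class (mat2 (1 - t) (- t) t (1 + t)) [^]\<^bsub>PGL2 UNIV\<^esub> n =
     proj_class (mat2 (1 - of_nat n * t) (- (of_nat n * t)) (of_nat n * t) (1 + of_nat n * t))"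
proof (induction n)
  case 0
  show ?case by (simp add: one_PGL2 nat_pow_def)
next
  case (Suc n)
  \<comment> \<open>The determinant is 1 for every parameter, so \<open>proj_class_mult\<close>
    applies to both factors.\<close>
  have "det (mat2 (1 - s) (- s) s (1 + s)) \<noteq> 0" for s :: 'a
    by (simp add: algebra_simps)
  then show ?case
    using Suc by (simp add: nat_pow_def proj_class_mult algebra_simps)
qed

section \<open>Element orders and roots of unity\<close>

lemma (in group) ord_eq_2:
  assumes "x \<in> carrier G" "x \<noteq> \<one>" "x \<otimes> x = \<one>"
  shows "ord x = 2"
proof -
  have "x [^] (2::nat) = \<one>" using assms by (simp add: numeral_2_eq_2)
  then have "ord x dvd 2" using assms pow_eq_id by blast
  then have "ord x = 1 \<or> ord x = 2" using two_is_prime_nat unfolding prime_nat_iff by blast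
  then show ?thesis using assms ord_eq_1 by auto
qed

text \<open>Powers formed in \<open>H\<close> are powers formed in \<open>G\<close>, so the same
  exponents kill \<open>x\<close>, and these determine the order.\<close>

lemma (in group) ord_consistent:
  assumes "subgroup H G" "x \<in> H"
  shows "group.ord (G\<lparr>carrier := H\<rparr>) x = ord x"
proof -
  have "x \<in> carrier G" using assms subgroup.subset by blast
  then show ?thesis
    using group.ord_unique[OF subgroup_imp_group[OF assms(1)], of x] assms(2) pow_eq_id
    by (simp flip: nat_pow_consistent)
qed

text \<open>Exponents may be reduced modulo \<open>n\<close>; by minimality of \<open>n\<close>, a
  remainder giving 1 must be 0.\<close>

lemma primitive_root_unity_pow_eq_1_iff:
  assumes "primitive_root_unity n x"
  shows "x ^ m = 1 \<longleftrightarrow> n dvd m"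
proof
  have n: "n > 0" "x ^ n = 1" using assms by (auto simp: primitive_root_unity_def)
  have "x ^ m = (x ^ n) ^ (m div n) * x ^ (m mod n)"
    by (simp flip: power_mult power_add)
  with n have *: "x ^ m = x ^ (m mod n)" by simp
  show "n dvd m" if "x ^ m = 1"
    using assms * that n unfolding primitive_root_unity_def
    by (metis dvd_eq_mod_eq_0 mod_less_divisor not_gr_zero)
  show "x ^ m = 1" if "n dvd m" using n that by (auto simp: power_mult elim!: dvdE)
qed

theorem proposition3p7:
  fixes p q e k :: nat
    and \<xi> \<omega> \<eta> \<alpha> :: "'a::alg_closed_field"
    and X Y Z :: "('a ^ 2 ^ 2) set"
    and G :: "('a ^ 2 ^ 2) set monoid"
  assumes "prime p" and "odd p" and "e \<ge> 1" and "q = p ^ e"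
    and "is_alg_closure_of_GF TYPE('a) p"
    and "k \<ge> 3" and "even k" and "coprime k p"
    and "1 / real k + 1 / real p < 1 / 2"
    and "primitive_root_unity (2 * k) \<xi>"
    and "\<xi> \<in> GF q \<or> \<xi> \<in> GF (q ^ 2)"
    and "\<omega> = \<xi> + inverse \<xi>"
    and "\<alpha> ^ 2 = -1"
    and "\<eta> = inverse (\<xi> - inverse \<xi>)"
    and "X = proj_class (map_matrix ((*) (\<eta> * \<alpha>)) (mat2 (- \<omega>) (- 2 * \<xi>) (2 * inverse \<xi>) \<omega>))"
    and "Y = proj_class (map_matrix ((*) (- \<alpha>)) (mat2 0 \<xi> (inverse \<xi>) 0))"
    and "Z = proj_class (map_matrix ((*) \<alpha>) (mat2 0 1 1 0))"
    and "G = (PGL2 UNIV)\<lparr>carrier := generate (PGL2 UNIV) {X, Y, Z}\<rparr>"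
    and "G \<cong> PSL2 (GF q :: 'a set) \<or> G \<cong> PGL2 (GF q :: 'a set)"
  shows "moebius_regular G X Y Z k p \<longleftrightarrow> \<omega> ^ 2 + 4 = 0"
proof -
  interpret group "PGL2 (UNIV :: 'a set)" by (rule group_PGL2)
  note [simp] = proj_class_carrier proj_class_mult

  \<comment> \<open>Arithmetic of \<xi>, \<omega> and \<mu>, and unnormalised generators\<close>
  have "p \<noteq> 2" using \<open>odd p\<close> by auto
  have char: "of_nat n = (0 :: 'a) \<longleftrightarrow> p dvd n" for n
    using \<open>is_alg_closure_of_GF TYPE('a) p\<close>
    by (simp add: is_alg_closure_of_GF_def of_nat_eq_0_iff_char_dvd)
  have two: "(2 :: 'a) \<noteq> 0"
    using char[of 2] primes_dvd_imp_eq[OF \<open>prime p\<close> two_is_prime_nat] \<open>p \<noteq> 2\<close> by auto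
  have four: "(4 :: 'a) \<noteq> 0"
    using two by (metis mult_2_right mult_eq_0_iff numeral_Bit0 numeral_times_numeral)
  note root = primitive_root_unity_pow_eq_1_iff[OF \<open>primitive_root_unity (2 * k) \<xi>\<close>]
  have \<xi>: "\<xi> \<noteq> 0" using root[of "2 * k"] \<open>k \<ge> 3\<close> by (auto simp: power_0_left)
  \<comment> \<open>From \<open>k \<ge> 3\<close>, the order \<open>2 * k\<close> of \<xi> is at
    least 6 and divides neither 2 nor 4.\<close>
  have \<xi>2: "\<xi> ^ 2 \<noteq> 1" using root[of 2] \<open>k \<ge> 3\<close> by (auto dest: dvd_imp_le)
  have \<xi>4: "\<xi> ^ 4 \<noteq> 1" using root[of 4] \<open>k \<ge> 3\<close> by (auto dest: dvd_imp_le)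
  have \<xi>k: "\<xi> ^ k = - 1"
  proof -
    have "(\<xi> ^ k) ^ 2 = 1" using root[of "2 * k"] by (simp add: power_mult mult.commute)
    moreover have "\<xi> ^ k \<noteq> 1" using root[of k] \<open>k \<ge> 3\<close> by (auto dest: dvd_imp_le)
    ultimately show ?thesis by (simp add: power2_eq_1_iff)
  qed
  have \<omega>: "\<omega> \<noteq> 0"
  proof
    assume "\<omega> = 0"
    then have "\<xi> * \<xi> = - 1" using \<xi> assms(12) by (simp add: field_simps add_eq_0_iff)
    then have "\<xi> ^ 4 = 1" by (simp add: power4_eq_xxxx)
    with \<xi>4 show False by simp
  qed
  \<comment> \<open>This is the inverse of \<eta>. All determinants below reduce to powers of \<mu>,
    up to sign, through \<open>\<omega> ^ 2 - 4 = \<mu> ^ 2\<close>.\<close>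
  define \<mu> where "\<mu> = \<xi> - inverse \<xi>"
  have \<mu>: "\<mu> \<noteq> 0" using \<xi> \<xi>2 by (simp add: \<mu>_def field_simps power2_eq_square)
  have \<omega>\<mu>: "\<omega> ^ 2 - 4 = \<mu> ^ 2"
    using \<xi> unfolding assms(12) \<mu>_def by (simp add: field_simps power2_eq_square)
  have \<alpha>: "\<alpha> \<noteq> 0" using \<open>\<alpha> ^ 2 = -1\<close> by auto
  have \<eta>: "\<eta> \<noteq> 0" using \<mu> assms(14) by (simp add: \<mu>_def)
  have detX: "- \<omega> * \<omega> - (- 2 * \<xi>) * (2 * inverse \<xi>) \<noteq> 0"
  proof -
    have "- \<omega> * \<omega> - (- 2 * \<xi>) * (2 * inverse \<xi>) = - (\<mu> ^ 2)"
      using \<xi> unfolding \<omega>\<mu>[symmetric] by (simp add: power2_eq_square)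
    with \<mu> show ?thesis by simp
  qed
  have unscale: "proj_class (map_matrix ((*) s) (mat2 a b c d)) = proj_class (mat2 a b c d)"
    if "s \<noteq> 0" "a * d - b * c \<noteq> 0" for s a b c d :: 'a
  proof -
    have "(s * a) * (s * d) - (s * b) * (s * c) = s ^ 2 * (a * d - b * c)"
      by (simp add: algebra_simps power2_eq_square)
    with that have "(s * a) * (s * d) - (s * b) * (s * c) \<noteq> 0" by simp
    with that show ?thesis unfolding map_matrix_mat2 by (subst proj_class_mat2_eq_iff) auto
  qed
  have X: "X = proj_class (mat2 (- \<omega>) (- 2 * \<xi>) (2 * inverse \<xi>) \<omega>)"
    using \<eta> \<alpha> detX unfolding assms(15) by (intro unscale) simp_all
  have Y: "Y = proj_class (mat2 0 \<xi> (inverse \<xi>) 0)"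
    using \<alpha> \<xi> unfolding assms(16) by (intro unscale) simp_all
  have Z: "Z = proj_class (mat2 0 1 1 0)"
    using \<alpha> unfolding assms(17) by (intro unscale) simp_all
  have carrier: "{X, Y, Z} \<subseteq> carrier (PGL2 UNIV)"
    using detX \<xi> by (simp add: X Y Z)

  \<comment> \<open>Orders of the generators and of their products\<close>
  have XX: "X \<otimes>\<^bsub>PGL2 UNIV\<^esub> X = \<one>\<^bsub>PGL2 UNIV\<^esub>"
  proof -
    \<comment> \<open>A matrix of trace 0 squares to minus its determinant, here
      \<open>\<mu> ^ 2\<close>. Below, \<open>mat2_mult\<close> is switched off so that this
      equation can rewrite the product.\<close>
    have "mat2 (- \<omega>) (- 2 * \<xi>) (2 * inverse \<xi>) \<omega> ** mat2 (- \<omega>) (- 2 * \<xi>) (2 * inverse \<xi>) \<omega>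
        = mat2 (\<mu> ^ 2) 0 0 (\<mu> ^ 2)"
      using \<xi> unfolding \<omega>\<mu>[symmetric] by (simp add: mat2_eq_iff power2_eq_square)
    then show ?thesis
      using detX \<mu> by (simp add: X proj_class_mat2_eq_one_iff del: mat2_mult)
  qed
  have ordX: "ord X = 2"
  proof (rule ord_eq_2)
    show "X \<noteq> \<one>\<^bsub>PGL2 UNIV\<^esub>"
      unfolding X using detX two \<xi> by (subst proj_class_mat2_eq_one_iff) auto
  qed (use carrier XX in auto)
  have ordY: "ord Y = 2"
    using \<xi> by (intro ord_eq_2) (simp_all add: Y proj_class_mat2_eq_one_iff)
  have ordZ: "ord Z = 2"
    by (intro ord_eq_2) (simp_all add: Z proj_class_mat2_eq_one_iff)
  have XY: "X \<otimes>\<^bsub>PGL2 UNIV\<^esub> Y = proj_class (mat2 (- 2) (- (\<omega> * \<xi>)) (\<omega> * inverse \<xi>) 2)"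
    using detX \<xi> by (simp add: X Y mult.assoc)
  have ordXY: "ord (X \<otimes>\<^bsub>PGL2 UNIV\<^esub> Y) = 2"
  proof (rule ord_eq_2)
    \<comment> \<open>Again the trace is 0, so the square is the scalar
      \<open>- (\<mu> ^ 2)\<close>. The matrix itself is not scalar, since its diagonal entries -2
      and 2 differ in odd characteristic.\<close>
    have det: "(- 2) * 2 - (- (\<omega> * \<xi>)) * (\<omega> * inverse \<xi>) = \<mu> ^ 2"
      using \<xi> unfolding \<omega>\<mu>[symmetric] by (simp add: power2_eq_square)
    have "(- 2 :: 'a) \<noteq> 2"
      using four by (metis add.right_inverse numeral_Bit0)
    then show "X \<otimes>\<^bsub>PGL2 UNIV\<^esub> Y \<noteq> \<one>\<^bsub>PGL2 UNIV\<^esub>"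
      unfolding XY using det \<mu> by (subst proj_class_mat2_eq_one_iff) auto
    have "mat2 (- 2) (- (\<omega> * \<xi>)) (\<omega> * inverse \<xi>) 2 ** mat2 (- 2) (- (\<omega> * \<xi>)) (\<omega> * inverse \<xi>) 2
        = mat2 (- (\<mu> ^ 2)) 0 0 (- (\<mu> ^ 2))"
      using \<xi> unfolding \<omega>\<mu>[symmetric] by (simp add: mat2_eq_iff power2_eq_square)
    then show "X \<otimes>\<^bsub>PGL2 UNIV\<^esub> Y \<otimes>\<^bsub>PGL2 UNIV\<^esub> (X \<otimes>\<^bsub>PGL2 UNIV\<^esub> Y) = \<one>\<^bsub>PGL2 UNIV\<^esub>"
      unfolding XY using det \<mu>
      by (simp add: proj_class_mat2_eq_one_iff del: mat2_mult)
  qed (use carrier in auto)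
  have YZ: "Y \<otimes>\<^bsub>PGL2 UNIV\<^esub> Z = proj_class (mat2 \<xi> 0 0 (inverse \<xi>))"
    using \<xi> by (simp add: Y Z)
  have ordYZ: "ord (Y \<otimes>\<^bsub>PGL2 UNIV\<^esub> Z) = k"
  proof -
    have "(Y \<otimes>\<^bsub>PGL2 UNIV\<^esub> Z) [^]\<^bsub>PGL2 UNIV\<^esub> n = \<one>\<^bsub>PGL2 UNIV\<^esub> \<longleftrightarrow> k dvd n" for n :: nat
    proof -
      have "(Y \<otimes>\<^bsub>PGL2 UNIV\<^esub> Z) [^]\<^bsub>PGL2 UNIV\<^esub> n = \<one>\<^bsub>PGL2 UNIV\<^esub> \<longleftrightarrow> \<xi> ^ n = inverse \<xi> ^ n"
        using \<xi> by (simp add: YZ proj_class_diagonal_pow proj_class_mat2_eq_one_iff)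
      \<comment> \<open>A diagonal matrix is scalar once its two entries agree. This doubles the
        exponent, which is why a root of order \<open>2 * k\<close> gives an element of order
        \<open>k\<close>.\<close>
      also have "\<dots> \<longleftrightarrow> \<xi> ^ (2 * n) = 1"
        using \<xi> by (simp add: mult_2 power_add power_one_over inverse_eq_divide eq_divide_eq)
      finally show ?thesis by (simp add: root)
    qed
    then show ?thesis using carrier by (subst ord_unique) auto
  qed
  \<comment> \<open>The matrix of \<open>ZX\<close> has trace \<open>- 2 * \<mu>\<close> and
    determinant \<open>\<mu> ^ 2\<close>, hence the double eigenvalue \<open>- \<mu>\<close>.
    Dividing by it leaves a unipotent matrix with parameter \<open>t\<close>.\<close>
  define t where "t = \<omega> / \<mu>"
  have ZX: "Z \<otimes>\<^bsub>PGL2 UNIV\<^esub> X = proj_class (mat2 (1 - t) (- t) t (1 + t))"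
  proof -
    have \<mu>t: "\<mu> * t = \<omega>" using \<mu> by (simp add: t_def)
    have "Z \<otimes>\<^bsub>PGL2 UNIV\<^esub> X = proj_class (mat2 (2 * inverse \<xi>) \<omega> (- \<omega>) (- 2 * \<xi>))"
      using detX by (simp add: X Z)
    also have "mat2 (2 * inverse \<xi>) \<omega> (- \<omega>) (- 2 * \<xi>) =
        map_matrix ((*) (- \<mu>)) (mat2 (1 - t) (- t) t (1 + t))"
      by (simp add: mat2_eq_iff distrib_left right_diff_distrib \<mu>t) (simp add: \<mu>_def assms(12))
    also have "proj_class \<dots> = proj_class (mat2 (1 - t) (- t) t (1 + t))"
      using \<mu> by (intro unscale) (simp_all add: algebra_simps)
    finally show ?thesis .
  qed
  have ordZX: "ord (Z \<otimes>\<^bsub>PGL2 UNIV\<^esub> X) = p"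
  proof -
    have "(Z \<otimes>\<^bsub>PGL2 UNIV\<^esub> X) [^]\<^bsub>PGL2 UNIV\<^esub> n = \<one>\<^bsub>PGL2 UNIV\<^esub> \<longleftrightarrow> p dvd n" for n :: nat
    proof -
      \<comment> \<open>The off-diagonal entries decide. As \<open>t\<close> is nonzero because
        \<omega> is, they vanish exactly when \<open>n\<close> is 0 in the field.\<close>
      have "(Z \<otimes>\<^bsub>PGL2 UNIV\<^esub> X) [^]\<^bsub>PGL2 UNIV\<^esub> n = \<one>\<^bsub>PGL2 UNIV\<^esub> \<longleftrightarrow> of_nat n * t = 0"
        unfolding ZX proj_class_unipotent_pow
        by (subst proj_class_mat2_eq_one_iff) (auto simp: algebra_simps)
      then show ?thesis using \<omega> \<mu> by (simp add: t_def char)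
    qed
    then show ?thesis using carrier by (subst ord_unique) auto
  qed

  \<comment> \<open>The Moebius condition\<close>
  define R where "R = Y \<otimes>\<^bsub>PGL2 UNIV\<^esub> Z"
  define H where "H = R [^]\<^bsub>PGL2 UNIV\<^esub> (k div 2)"
  have H: "H = proj_class (mat2 1 0 0 (- 1))"
  proof -
    \<comment> \<open>As a square root of -1, \<open>\<xi> ^ (k div 2)\<close> has its own negative
      as inverse; factoring it out leaves the entries 1 and -1.\<close>
    have sq: "(\<xi> ^ (k div 2)) ^ 2 = - 1"
      using \<open>even k\<close> \<xi>k by (simp flip: power_mult)
    then have "inverse \<xi> ^ (k div 2) = - (\<xi> ^ (k div 2))"
      using \<xi> by (simp add: field_simps power2_eq_square)
    then have "H = proj_class (map_matrix ((*) (\<xi> ^ (k div 2))) (mat2 1 0 0 (- 1)))"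
      using \<xi> by (simp add: H_def R_def YZ proj_class_diagonal_pow)
    also have "\<dots> = proj_class (mat2 1 0 0 (- 1))"
      using \<xi> two by (intro unscale) simp_all
    finally show ?thesis .
  qed
  have XHX: "X \<otimes>\<^bsub>PGL2 UNIV\<^esub> H \<otimes>\<^bsub>PGL2 UNIV\<^esub> X =
    proj_class (mat2 (\<omega> ^ 2 + 4) (4 * \<xi> * \<omega>) (- 4 * \<omega> * inverse \<xi>) (- (\<omega> ^ 2 + 4)))"
  proof -
    have "X \<otimes>\<^bsub>PGL2 UNIV\<^esub> H \<otimes>\<^bsub>PGL2 UNIV\<^esub> X = proj_class
        (mat2 (- \<omega>) (- 2 * \<xi>) (2 * inverse \<xi>) \<omega> ** mat2 1 0 0 (- 1)
          ** mat2 (- \<omega>) (- 2 * \<xi>) (2 * inverse \<xi>) \<omega>)"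
      using detX by (simp add: X H det_mul del: mat2_mult)
    also have "mat2 (- \<omega>) (- 2 * \<xi>) (2 * inverse \<xi>) \<omega> ** mat2 1 0 0 (- 1)
          ** mat2 (- \<omega>) (- 2 * \<xi>) (2 * inverse \<xi>) \<omega> =
        mat2 (\<omega> ^ 2 + 4) (4 * \<xi> * \<omega>) (- 4 * \<omega> * inverse \<xi>) (- (\<omega> ^ 2 + 4))"
      using \<xi> by (simp add: mat2_eq_iff power2_eq_square)
    finally show ?thesis .
  qed
  have HY: "H \<otimes>\<^bsub>PGL2 UNIV\<^esub> Y = proj_class (mat2 0 \<xi> (- inverse \<xi>) 0)"
    using \<xi> by (simp add: H Y)
  have key: "X \<otimes>\<^bsub>PGL2 UNIV\<^esub> H \<otimes>\<^bsub>PGL2 UNIV\<^esub> X = H \<otimes>\<^bsub>PGL2 UNIV\<^esub> Y \<longleftrightarrow> \<omega> ^ 2 + 4 = 0"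
  proof -
    \<comment> \<open>In agreement with multiplicativity: the factors \<open>X\<close>,
      \<open>H\<close>, \<open>X\<close> have determinants \<open>- (\<mu> ^ 2)\<close>, -1 and
      \<open>- (\<mu> ^ 2)\<close>.\<close>
    have "(\<omega> ^ 2 + 4) * (- (\<omega> ^ 2 + 4)) - 4 * \<xi> * \<omega> * (- 4 * \<omega> * inverse \<xi>)
        = - ((\<omega> ^ 2 - 4) ^ 2)"
      using \<xi> by (simp add: algebra_simps power2_eq_square)
    then have det: "(\<omega> ^ 2 + 4) * (- (\<omega> ^ 2 + 4)) - 4 * \<xi> * \<omega> * (- 4 * \<omega> * inverse \<xi>) \<noteq> 0"
      using \<mu> by (simp add: \<omega>\<mu>)
    have "X \<otimes>\<^bsub>PGL2 UNIV\<^esub> H \<otimes>\<^bsub>PGL2 UNIV\<^esub> X = H \<otimes>\<^bsub>PGL2 UNIV\<^esub> Y \<longleftrightarrow>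
        (\<exists>s. s \<noteq> 0 \<and> \<omega> ^ 2 + 4 = s * 0 \<and> 4 * \<xi> * \<omega> = s * \<xi> \<and>
          - 4 * \<omega> * inverse \<xi> = s * - inverse \<xi> \<and> - (\<omega> ^ 2 + 4) = s * 0)"
      unfolding XHX HY using det \<xi> by (intro proj_class_mat2_eq_iff) auto
    \<comment> \<open>The zero diagonal of \<open>HY\<close> forces
      \<open>\<omega> ^ 2 + 4 = 0\<close>. Conversely, the off-diagonal entries prescribe the factor
      \<open>4 * \<omega>\<close>, which is nonzero.\<close>
    also have "\<dots> \<longleftrightarrow> \<omega> ^ 2 + 4 = 0"
      using four \<omega> by (auto simp only: mult_zero_right minus_zero intro!: exI[of _ "4 * \<omega>"]) (simp_all add: mult.commute)
    finally show ?thesis .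
  qed

  \<comment> \<open>Transfer from PGL(2,K) to the generated subgroup\<close>
  have subgr: "subgroup (generate (PGL2 UNIV) {X, Y, Z}) (PGL2 UNIV)"
    using carrier by (rule generate_is_subgroup)
  have gen: "x \<in> generate (PGL2 UNIV) {X, Y, Z}" if "x \<in> {X, Y, Z}" for x
    using that by (rule generate.incl)
  \<comment> \<open>\<open>G\<close> inherits its operation from PGL(2,K), and
    \<open>generate.eng\<close> places the three products in its carrier, so all orders computed
    above carry over by \<open>ord_consistent\<close>.\<close>
  have "regular_map G X Y Z k p"
    unfolding regular_map_def assms(18)
    using subgroup_imp_group[OF subgr] generate_consistent[OF _ subgr, of "{X, Y, Z}"] gen
      generate.eng[OF gen gen] ordX ordY ordZ ordXY ordYZ ordZX
    by (auto simp: ord_consistent[OF subgr])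
  moreover have "(Y \<otimes>\<^bsub>G\<^esub> Z) [^]\<^bsub>G\<^esub> (k div 2) = H"
    unfolding H_def R_def assms(18) by (simp flip: nat_pow_consistent)
  moreover have "mult G = mult (PGL2 UNIV)" by (simp add: assms(18))
  ultimately show ?thesis using key \<open>even k\<close> by (simp add: moebius_regular_def Let_def)
qed

end
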